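(* Let $(G,p)$ be a polarized diagram and let $\mathcal{R}_{(G,p)}:=(V(G),\emptyset,E(G),p)$. Then for every PRN $\mathcal{R}$, we have $\mathcal{R}_{(G,p)}\hookrightarrow^{*}\mathcal{R}$ if and only if $\mathcal{R}$ is a strict polarized rectifier network realizing $(G,p)$.
   Context: A diagram is a loopless graph with undirected and directed edges such that for all $u,v$ at most one of $\{u,v\},(u,v),(v,u)$ is an edge. A polarized diagram of a diagram is a pair $(G,p)$ where $G$ is the directed graph obtained by orienting each undirected edge arbitrarily and $p:E(G)\to\{-,+\}$ assigns $-$ to formerly undirected edges and $+$ to originally directed edges. A polarized rectifier network (PRN) is $\mathcal{R}=(B,A,E,p)$ with $B,A$ disjoint vertex sets (base and auxiliary), $(B\sqcup A,E)$ a loopless directed graph, and $p:\{(u,v)\in E: v\in B\}\to\{-,+\}$. For $u,v\in B$ (possibly equal), a valid walk from $u$ to $v$ is a sequence $(\pi_1,\dots,\pi_k)$, $k\ge2$, with $\pi_1=u$, $\pi_k=v$, each $(\pi_i,\pi_{i+1})\in E$, and $\pi_i\in A$ for $2\le i\le k-1$; its polarity is $p(\pi_{k-1},\pi_k)$. A PRN $(V(G),A,E,p')$ realizes $(G,p)$ if for all $u,v\in V(G)$ (possibly equal), $(u,v)\in E(G)$ iff there is a valid walk from $u$ to $v$ with polarity $p(u,v)$ (and there is no valid walk from $u$ to $v$ when $(u,v)\notin E(G)$). A PRN is strict if (1) for every 2-element $\{u,v\}\subseteq B$ there is at most one valid walk from $u$ to $v$ or from $v$ to $u$ in total, and (2)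 every vertex of $A$ lies on some valid walk. A coherent biclique of a PRN $(B,A,E,p)$ is a pair $(X,Y)$ of disjoint nonempty subsets of $B\sqcup A$ such that $(x,y)\in E$ for all $x\in X,y\in Y$, and $p(x_1,y)=p(x_2,y)$ for all $y\in Y\cap B$ and $x_1,x_2\in X$. The biclique reduction of $\mathcal{R}$ with respect to $(X,Y)$ is the PRN $(B,A\sqcup\{z\},E',p')$ for a new vertex $z$, where $E'=(E\setminus(X\times Y))\cup\{(x,z):x\in X\}\cup\{(z,y):y\in Y\}$, $p'(z,y)=p(x,y)$ for $y\in Y\cap B$ (for any $x\in X$), and $p'=p$ otherwise. We write $\mathcal{R}\hookrightarrow\mathcal{R}'$ if $\mathcal{R}'$ is a biclique reduction of $\mathcal{R}$, and $\hookrightarrow^{*}$ for the reflexive transitive closure (with PRNs identified up to the naming of new auxiliary vertices).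
   Formalization: Diagrams and PRNs are taken to be finite; for a diagram with infinitely many edges the claim fails, since subdividing every edge gives a strict PRN realizing (G,p) that no finite sequence of biclique reductions reaches. *)

theory Defs
  imports "Graph_Theory.Pair_Digraph"
begin

text \<open>All graphs and networks are finite: \<open>pair_digraph\<close> is the library's notion of a finite
  loopless directed graph whose arcs are pairs of vertices.\<close>

datatype polarity = Minus | Plus

record 'v diagram =
  dverts :: "'v set"
  uedges :: "'v set set"
  dedges :: "'v rel"

definition diagram :: "'v diagram \<Rightarrow> bool" where
  "diagram D \<longleftrightarrow>
     finite (dverts D) \<and>
     uedges D \<subseteq> {{u, v} |u v. u \<in> dverts D \<and> v \<in> dverts D \<and> u \<noteq> v} \<and>
     dedges D \<subseteq> {(u, v). u \<in> dverts D \<and> v \<in> dverts D \<and> u \<noteq> v} \<and>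
     (\<forall>u v. \<not> ({u, v} \<in> uedges D \<and> (u, v) \<in> dedges D) \<and>
            \<not> ({u, v} \<in> uedges D \<and> (v, u) \<in> dedges D) \<and>
            \<not> ((u, v) \<in> dedges D \<and> (v, u) \<in> dedges D))"

definition orientation_of :: "'v set set \<Rightarrow> 'v rel \<Rightarrow> bool" where
  "orientation_of U Or \<longleftrightarrow>
     (\<forall>(u, v) \<in> Or. {u, v} \<in> U) \<and>
     (\<forall>u v. {u, v} \<in> U \<longrightarrow> ((u, v) \<in> Or \<longleftrightarrow> (v, u) \<notin> Or))"

definition polarized_diagram_of ::
  "'v diagram \<Rightarrow> 'v pair_pre_digraph \<Rightarrow> ('v \<times> 'v \<rightharpoonup> polarity) \<Rightarrow> bool" where
  "polarized_diagram_of D G p \<longleftrightarrow>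
     (\<exists>Or. orientation_of (uedges D) Or \<and>
           G = \<lparr>pverts = dverts D, parcs = Or \<union> dedges D\<rparr> \<and>
           dom p = parcs G \<and>
           (\<forall>e \<in> Or. p e = Some Minus) \<and>
           (\<forall>e \<in> dedges D. p e = Some Plus))"

definition polarized_diagram :: "'v pair_pre_digraph \<Rightarrow> ('v \<times> 'v \<rightharpoonup> polarity) \<Rightarrow> bool" where
  "polarized_diagram G p \<longleftrightarrow> (\<exists>D. diagram D \<and> polarized_diagram_of D G p)"

text \<open>The polarity is a partial function whose domain is exactly the set of arcs into base vertices,
  so that equality of records is equality of networks.\<close>

record 'v prn =
  base :: "'v set"
  aux :: "'v set"
  edges :: "'v rel"
  pol :: "'v \<times> 'v \<rightharpoonup> polarity"

definition prn :: "'v prn \<Rightarrow> bool" where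
  "prn R \<longleftrightarrow>
     base R \<inter> aux R = {} \<and>
     pair_digraph \<lparr>pverts = base R \<union> aux R, parcs = edges R\<rparr> \<and>
     dom (pol R) = {(u, v) \<in> edges R. v \<in> base R}"

definition valid_walk :: "'v prn \<Rightarrow> 'v \<Rightarrow> 'v \<Rightarrow> 'v list \<Rightarrow> bool" where
  "valid_walk R u v w \<longleftrightarrow>
     u \<in> base R \<and> v \<in> base R \<and> length w \<ge> 2 \<and> hd w = u \<and> last w = v \<and>
     (\<forall>i. i + 1 < length w \<longrightarrow> (w ! i, w ! (i + 1)) \<in> edges R) \<and>
     (\<forall>i. 0 < i \<and> i + 1 < length w \<longrightarrow> w ! i \<in> aux R)"

definition walk_polarity :: "'v prn \<Rightarrow> 'v list \<Rightarrow> polarity option" where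
  "walk_polarity R w = pol R (w ! (length w - 2), w ! (length w - 1))"

definition realizes ::
  "'v prn \<Rightarrow> 'v pair_pre_digraph \<Rightarrow> ('v \<times> 'v \<rightharpoonup> polarity) \<Rightarrow> bool" where
  "realizes R G p \<longleftrightarrow>
     base R = pverts G \<and>
     (\<forall>u \<in> pverts G. \<forall>v \<in> pverts G.
        ((u, v) \<in> parcs G \<longleftrightarrow> (\<exists>w. valid_walk R u v w \<and> walk_polarity R w = p (u, v))) \<and>
        ((u, v) \<notin> parcs G \<longrightarrow> \<not> (\<exists>w. valid_walk R u v w)))"

definition strict_prn :: "'v prn \<Rightarrow> bool" where
  "strict_prn R \<longleftrightarrow>
     prn R \<and>
     (\<forall>u \<in> base R. \<forall>v \<in> base R. u \<noteq> v \<longrightarrow>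
        (\<exists>\<^sub>\<le>\<^sub>1w. valid_walk R u v w \<or> valid_walk R v u w)) \<and>
     (\<forall>a \<in> aux R. \<exists>u v w. valid_walk R u v w \<and> a \<in> set w)"

definition coherent_biclique :: "'v prn \<Rightarrow> 'v set \<Rightarrow> 'v set \<Rightarrow> bool" where
  "coherent_biclique R X Y \<longleftrightarrow>
     X \<subseteq> base R \<union> aux R \<and> Y \<subseteq> base R \<union> aux R \<and> X \<inter> Y = {} \<and> X \<noteq> {} \<and> Y \<noteq> {} \<and>
     X \<times> Y \<subseteq> edges R \<and>
     (\<forall>y \<in> Y \<inter> base R. \<forall>x\<^sub>1 \<in> X. \<forall>x\<^sub>2 \<in> X. pol R (x\<^sub>1, y) = pol R (x\<^sub>2, y))"

definition biclique_reduction :: "'v prn \<Rightarrow> 'v set \<Rightarrow> 'v set \<Rightarrow> 'v \<Rightarrow> 'v prn" where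
  "biclique_reduction R X Y z =
     \<lparr>base = base R,
      aux = insert z (aux R),
      edges = (edges R - X \<times> Y) \<union> {(x, z) |x. x \<in> X} \<union> {(z, y) |y. y \<in> Y},
      pol = (\<lambda>(u, v).
        if u = z then (if v \<in> Y \<inter> base R then pol R (SOME x. x \<in> X, v) else None)
        else if (u, v) \<in> X \<times> Y then None
        else pol R (u, v))\<rparr>"

definition reduces :: "'v prn \<Rightarrow> 'v prn \<Rightarrow> bool" (infix \<open>\<hookrightarrow>\<close> 50) where
  "R \<hookrightarrow> R' \<longleftrightarrow> prn R \<and>
     (\<exists>X Y z. coherent_biclique R X Y \<and> z \<notin> base R \<union> aux R \<and> R' = biclique_reduction R X Y z)"

definition aux_renaming :: "'v prn \<Rightarrow> 'v prn \<Rightarrow> bool" where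
  "aux_renaming R R' \<longleftrightarrow>
     prn R \<and> prn R' \<and> base R' = base R \<and>
     (\<exists>f. bij_betw f (aux R) (aux R') \<and> (\<forall>b \<in> base R. f b = b) \<and>
          edges R' = map_prod f f ` edges R \<and>
          (\<forall>(u, v) \<in> edges R. v \<in> base R \<longrightarrow> pol R' (f u, f v) = pol R (u, v)))"

text \<open>Networks are identified up to the names of auxiliary vertices by admitting renamings as
  additional steps of the closure.\<close>

definition reduces_star :: "'v prn \<Rightarrow> 'v prn \<Rightarrow> bool" (infix \<open>\<hookrightarrow>\<^sup>*\<close> 50) where
  "R \<hookrightarrow>\<^sup>* R' \<longleftrightarrow> (\<lambda>S S'. S \<hookrightarrow> S' \<or> aux_renaming S S')\<^sup>*\<^sup>* R R'"

definition prn_of_diagram :: "'v pair_pre_digraph \<Rightarrow> ('v \<times> 'v \<rightharpoonup> polarity) \<Rightarrow> 'v prn" where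
  "prn_of_diagram G p = \<lparr>base = pverts G, aux = {}, edges = parcs G, pol = p\<rparr>"

lemma prn_of_diagram_prn: "polarized_diagram G p \<Longrightarrow> prn (prn_of_diagram G p)"
proof -
  assume "polarized_diagram G p"
  then obtain D Or where D: "diagram D" and Or: "orientation_of (uedges D) Or"
    and G: "G = \<lparr>pverts = dverts D, parcs = Or \<union> dedges D\<rparr>" and p: "dom p = parcs G"
    unfolding polarized_diagram_def polarized_diagram_of_def by blast
  have arcs: "u \<in> dverts D \<and> v \<in> dverts D \<and> u \<noteq> v" if "(u, v) \<in> Or \<union> dedges D" for u v
  proof (cases "(u, v) \<in> Or")
    case True
    then have "{u, v} \<in> uedges D"
      using Or by (auto simp: orientation_of_def)
    moreover have "uedges D \<subseteq> {{u, v} |u v. u \<in> dverts D \<and> v \<in> dverts D \<and> u \<noteq> v}"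
      using D by (simp add: diagram_def)
    ultimately obtain a b where "{u, v} = {a, b}" "a \<in> dverts D" "b \<in> dverts D" "a \<noteq> b"
      by blast
    then show ?thesis by (auto simp: doubleton_eq_iff)
  next
    case False
    then have "(u, v) \<in> dedges D" using that by simp
    moreover have "dedges D \<subseteq> {(u, v). u \<in> dverts D \<and> v \<in> dverts D \<and> u \<noteq> v}"
      using D by (simp add: diagram_def)
    ultimately show ?thesis by blast
  qed
  have finV: "finite (dverts D)" using D by (simp add: diagram_def)
  have "Or \<union> dedges D \<subseteq> dverts D \<times> dverts D"
    using arcs by (intro subrelI) simp
  then have finE: "finite (Or \<union> dedges D)" using finV by (meson finite_SigmaI finite_subset)
  have "pair_digraph \<lparr>pverts = dverts D, parcs = Or \<union> dedges D\<rparr>"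
  proof (unfold_locales, goal_cases)
    case (1 e) then show ?case using arcs[of "fst e" "snd e"] by simp
  next
    case (2 e) then show ?case using arcs[of "fst e" "snd e"] by simp
  next
    case 3 then show ?case using finV by simp
  next
    case 4 then show ?case using finE by simp
  next
    case (5 e) then show ?case using arcs[of "fst e" "snd e"] by simp
  qed
  moreover have "{(u, v). (u, v) \<in> parcs G \<and> v \<in> pverts G} = parcs G"
    using arcs unfolding G by auto
  ultimately show ?thesis
    using p unfolding prn_def prn_of_diagram_def G by simp
qed

lemma reduces_prn: "R \<hookrightarrow> R' \<Longrightarrow> prn R'"
proof -
  assume "R \<hookrightarrow> R'"
  then obtain X Y z where R: "prn R" and c: "coherent_biclique R X Y"
    and z: "z \<notin> base R \<union> aux R" and R': "R' = biclique_reduction R X Y z"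
    unfolding reduces_def by blast
  let ?G = "\<lparr>pverts = base R \<union> aux R, parcs = edges R\<rparr>"
  interpret G: pair_digraph ?G using R by (simp add: prn_def)
  have wf: "u \<in> base R \<union> aux R" "v \<in> base R \<union> aux R" "u \<noteq> v" if "(u, v) \<in> edges R" for u v
    using G.arc_fst_in_verts[of "(u, v)"] G.arc_snd_in_verts[of "(u, v)"]
      G.pair_no_loops[of "(u, v)"] that by auto
  have fin: "finite (base R \<union> aux R)"
    using G.pair_finite_verts by simp
  have X: "X \<subseteq> base R \<union> aux R" "Y \<subseteq> base R \<union> aux R" "X \<times> Y \<subseteq> edges R" "X \<noteq> {}"
    using c by (auto simp: coherent_biclique_def)
  have x: "(SOME x. x \<in> X) \<in> X" using X(4) by (simp add: some_in_eq)
  have p: "(pol R (u, v) \<noteq> None) = ((u, v) \<in> edges R \<and> v \<in> base R)" for u v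
    using R unfolding prn_def by (auto simp: dom_def set_eq_iff)
  have wf': "u \<in> base R' \<union> aux R' \<and> v \<in> base R' \<union> aux R' \<and> u \<noteq> v"
    if e: "(u, v) \<in> edges R'" for u v
  proof -
    consider "(u, v) \<in> edges R" | "u \<in> X" "v = z" | "u = z" "v \<in> Y"
      using e by (auto simp: R' biclique_reduction_def)
    then show ?thesis
    proof cases
      case 1
      from wf[OF this] show ?thesis by (auto simp: R' biclique_reduction_def)
    qed (use X(1,2) z in \<open>auto simp: R' biclique_reduction_def\<close>)
  qed
  have "edges R' \<subseteq> (base R' \<union> aux R') \<times> (base R' \<union> aux R')"
    using wf' by (intro subrelI) simp
  moreover have finV: "finite (base R' \<union> aux R')"
    using fin by (simp add: R' biclique_reduction_def)
  ultimately have finE: "finite (edges R')"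
    by (meson finite_SigmaI finite_subset)
  have graph: "pair_digraph \<lparr>pverts = base R' \<union> aux R', parcs = edges R'\<rparr>"
  proof (unfold_locales, goal_cases)
    case (1 e) then show ?case using wf'[of "fst e" "snd e"] by simp
  next
    case (2 e) then show ?case using wf'[of "fst e" "snd e"] by simp
  next
    case 3 then show ?case using finV by simp
  next
    case 4 then show ?case using finE by simp
  next
    case (5 e) then show ?case using wf'[of "fst e" "snd e"] by simp
  qed
  have "(pol R' (u, v) \<noteq> None) = ((u, v) \<in> edges R' \<and> v \<in> base R')" for u v
  proof (cases "u = z")
    case True
    define x where "x = (SOME x. x \<in> X)"
    have "x \<in> X" using x by (simp add: x_def)
    have "pol R' (u, v) = (if v \<in> Y \<inter> base R then pol R (x, v) else None)"
      using True by (simp add: R' biclique_reduction_def x_def)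
    moreover have "(z, v) \<notin> edges R" using wf z by blast
    moreover have "v \<in> Y \<Longrightarrow> (x, v) \<in> edges R" using X \<open>x \<in> X\<close> by blast
    moreover have "z \<notin> X" using X z by blast
    ultimately show ?thesis
      using p[of x v] True by (simp add: R' biclique_reduction_def)
  next
    case False
    then show ?thesis
      using p[of u v] z by (simp add: R' biclique_reduction_def) blast
  qed
  then have "dom (pol R') = {(u, v) \<in> edges R'. v \<in> base R'}" by (auto simp: dom_def)
  moreover have "base R' \<inter> aux R' = {}"
    using R z unfolding R' biclique_reduction_def prn_def by auto
  ultimately show ?thesis using graph unfolding prn_def by blast
qed

end

theory Submission
  imports Defs
begin

text \<open>
  Replacing every step \<open>x \<rightarrow> y\<close> with \<open>(x, y) \<in> X \<times> Y\<close> by \<open>x \<rightarrow> z \<rightarrow> y\<close> is a bijection between the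
  valid walks of a network and those of its biclique reduction; its inverse deletes \<open>z\<close>. It keeps
  endpoints and polarities, so strictness and realization are preserved by a reduction in both
  directions. Conversely, an auxiliary vertex \<open>z\<close> of a strict network realizing a loopless graph can
  be removed by joining its in-neighbours \<open>X\<close> directly to its out-neighbours \<open>Y\<close>. Uniqueness of
  walks makes \<open>X\<close> and \<open>Y\<close> disjoint and excludes prior edges from \<open>X\<close> to \<open>Y\<close>, so the original
  network is exactly the biclique reduction of the smaller one. Removing all auxiliary vertices
  leads back to the diagram.
\<close>

section \<open>Valid walks\<close>

lemma prn_edgeD:
  assumes "prn R" "(u, v) \<in> edges R"
  shows "u \<in> base R \<union> aux R" "v \<in> base R \<union> aux R" "u \<noteq> v"
proof -
  interpret G: pair_digraph "\<lparr>pverts = base R \<union> aux R, parcs = edges R\<rparr>"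
    using assms(1) by (simp add: prn_def)
  show "u \<in> base R \<union> aux R" "v \<in> base R \<union> aux R" "u \<noteq> v"
    using G.arc_fst_in_verts[of "(u, v)"] G.arc_snd_in_verts[of "(u, v)"]
      G.pair_no_loops[of "(u, v)"] assms(2) by auto
qed

lemma prn_finite: "prn R \<Longrightarrow> finite (base R \<union> aux R)"
  unfolding prn_def using pair_fin_digraph.pair_finite_verts pair_digraph.axioms by fastforce

lemma prnI:
  assumes "base R \<inter> aux R = {}" and fin: "finite (base R \<union> aux R)"
    and wf: "\<And>u v. (u, v) \<in> edges R \<Longrightarrow> u \<in> base R \<union> aux R \<and> v \<in> base R \<union> aux R \<and> u \<noteq> v"
    and "dom (pol R) = {(u, v) \<in> edges R. v \<in> base R}"
  shows "prn R"
proof -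
  have "edges R \<subseteq> (base R \<union> aux R) \<times> (base R \<union> aux R)"
    using wf by (intro subrelI) simp
  then have finE: "finite (edges R)"
    using fin by (meson finite_SigmaI finite_subset)
  have "pair_digraph \<lparr>pverts = base R \<union> aux R, parcs = edges R\<rparr>"
  proof (unfold_locales, goal_cases)
    case (1 e) then show ?case using wf[of "fst e" "snd e"] by simp
  next
    case (2 e) then show ?case using wf[of "fst e" "snd e"] by simp
  next
    case 3 then show ?case using fin by simp
  next
    case 4 then show ?case using finE by simp
  next
    case (5 e) then show ?case using wf[of "fst e" "snd e"] by simp
  qed
  then show ?thesis using assms unfolding prn_def by blast
qed

abbreviation edge_path :: "'v prn \<Rightarrow> 'v list \<Rightarrow> bool" where
  "edge_path R \<equiv> successively (\<lambda>a b. (a, b) \<in> edges R)"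

text \<open>Splitting off both endpoints replaces index arithmetic by a list \<open>m\<close> of
  interior vertices, which suits induction and concatenation. The case \<open>m = []\<close> is a
  single edge, the shortest walk allowed.\<close>

lemma valid_walk_iff:
  "valid_walk R u v w \<longleftrightarrow>
     u \<in> base R \<and> v \<in> base R \<and> edge_path R w \<and> (\<exists>m. w = u # m @ [v] \<and> set m \<subseteq> aux R)"
proof
  assume w: "valid_walk R u v w"
  then have len: "length w \<ge> 2" by (simp add: valid_walk_def)
  then obtain m where m: "w = u # m @ [v]"
    using w unfolding valid_walk_def
    by (cases w; cases "tl w" rule: rev_cases) auto
  have "a \<in> aux R" if "a \<in> set m" for a
  proof -
    obtain i where "i < length m" "m ! i = a"
      using \<open>a \<in> set m\<close> by (auto simp: in_set_conv_nth)
    then have "w ! (Suc i) = a" "Suc i + 1 < length w"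
      by (auto simp: m nth_append)
    then show ?thesis using w unfolding valid_walk_def by blast
  qed
  then show "u \<in> base R \<and> v \<in> base R \<and> edge_path R w \<and> (\<exists>m. w = u # m @ [v] \<and> set m \<subseteq> aux R)"
    using w m unfolding valid_walk_def by (auto simp: successively_conv_nth)
next
  assume r: "u \<in> base R \<and> v \<in> base R \<and> edge_path R w \<and> (\<exists>m. w = u # m @ [v] \<and> set m \<subseteq> aux R)"
  then obtain m where m: "w = u # m @ [v]" "set m \<subseteq> aux R" by blast
  have "w ! i \<in> aux R" if "0 < i" "i + 1 < length w" for i
    using that m by (cases i) (auto simp: nth_append)
  then show "valid_walk R u v w"
    using r m unfolding valid_walk_def by (auto simp: successively_conv_nth)
qed

lemma valid_walk_endpoints:
  assumes "valid_walk R u v w"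
  shows "hd w = u" "last w = v" "u \<in> base R" "v \<in> base R"
  using assms by (auto simp: valid_walk_def)

lemma walk_polarity_append: "walk_polarity R (l @ [a, b]) = pol R (a, b)"
  by (simp add: walk_polarity_def nth_append)

text \<open>The polarity of a walk is read off its final edge, so comparing polarities needs just
  this edge exposed.\<close>

lemma valid_walk_last_edge:
  assumes "valid_walk R u v w"
  obtains l a where "w = l @ [a, v]" "(a, v) \<in> edges R"
proof -
  obtain m where m: "w = (u # m) @ [v]" "edge_path R w"
    using assms by (auto simp: valid_walk_iff)
  obtain l a where "u # m = l @ [a]" by (cases "u # m" rule: rev_cases) auto
  then have "w = l @ [a, v]" using m by simp
  moreover from this have "(a, v) \<in> edges R"
    using m by (simp add: successively_append_iff)
  ultimately show ?thesis using that by blast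
qed

section \<open>Polarity-preserving bijections of valid walks\<close>

text \<open>A single map serves all pairs of endpoints, so that walks in the two directions between
  two vertices can be compared under the same \<open>\<phi>\<close>.\<close>

definition walk_bijection :: "('v list \<Rightarrow> 'v list) \<Rightarrow> 'v prn \<Rightarrow> 'v prn \<Rightarrow> bool" where
  "walk_bijection \<phi> R R' \<longleftrightarrow> base R' = base R \<and>
     (\<forall>u v. bij_betw \<phi> {w. valid_walk R u v w} {w. valid_walk R' u v w}) \<and>
     (\<forall>u v w. valid_walk R u v w \<longrightarrow> walk_polarity R' (\<phi> w) = walk_polarity R w)"

text \<open>Strictness is split in two: uniqueness only counts walks and passes along any bijection
  of walks, whereas coverage also looks at the vertices on them.\<close>

definition unique_walks :: "'v prn \<Rightarrow> bool" where
  "unique_walks R \<longleftrightarrow> (\<forall>u \<in> base R. \<forall>v \<in> base R. u \<noteq> v \<longrightarrow>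
     (\<exists>\<^sub>\<le>\<^sub>1w. valid_walk R u v w \<or> valid_walk R v u w))"

definition covered :: "'v prn \<Rightarrow> bool" where
  "covered R \<longleftrightarrow> (\<forall>a \<in> aux R. \<exists>u v w. valid_walk R u v w \<and> a \<in> set w)"

lemma strict_prn_iff: "strict_prn R \<longleftrightarrow> prn R \<and> unique_walks R \<and> covered R"
  by (simp add: strict_prn_def unique_walks_def covered_def)

context
  fixes \<phi> :: "'v list \<Rightarrow> 'v list" and R R' :: "'v prn"
  assumes \<phi>: "walk_bijection \<phi> R R'"
begin

lemma walk_bijection_image:
  "valid_walk R' u v w' \<longleftrightarrow> (\<exists>w. valid_walk R u v w \<and> w' = \<phi> w)"
proof -
  have "\<phi> ` {w. valid_walk R u v w} = {w. valid_walk R' u v w}"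
    using \<phi> by (simp add: walk_bijection_def bij_betw_def)
  then show ?thesis by blast
qed

text \<open>Since \<open>\<phi>\<close> keeps endpoints, equal images force equal endpoints, and
  injectivity for that one pair applies. This is what compares a walk from \<open>u\<close> to
  \<open>v\<close> with one from \<open>v\<close> to \<open>u\<close>.\<close>

lemma walk_bijection_inj:
  assumes "valid_walk R u v w" "valid_walk R s t w'" "\<phi> w = \<phi> w'"
  shows "w = w'"
proof -
  have "valid_walk R' u v (\<phi> w)" "valid_walk R' s t (\<phi> w)"
    using assms walk_bijection_image by metis+
  then have "u = s" "v = t" using valid_walk_endpoints by metis+
  moreover have "inj_on \<phi> {w. valid_walk R u v w}"
    using \<phi> by (simp add: walk_bijection_def bij_betw_def)
  ultimately show ?thesis using assms by (auto dest: inj_onD)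
qed

lemma walk_bijection_realizes: "realizes R' G p \<longleftrightarrow> realizes R G p"
proof -
  have base: "base R' = base R" using \<phi> by (simp add: walk_bijection_def)
  have pol: "walk_polarity R' (\<phi> w) = walk_polarity R w" if "valid_walk R u v w" for u v w
    using \<phi> that unfolding walk_bijection_def by blast
  have "(\<exists>w. valid_walk R' u v w \<and> walk_polarity R' w = c) \<longleftrightarrow>
        (\<exists>w. valid_walk R u v w \<and> walk_polarity R w = c)" for u v c
    unfolding walk_bijection_image using pol by metis
  moreover have "(\<exists>w. valid_walk R' u v w) \<longleftrightarrow> (\<exists>w. valid_walk R u v w)" for u v
    unfolding walk_bijection_image by blast
  ultimately show ?thesis unfolding realizes_def base by presburger
qed

lemma walk_bijection_unique: "unique_walks R' \<longleftrightarrow> unique_walks R"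
proof -
  have base: "base R' = base R" using \<phi> by (simp add: walk_bijection_def)
  have "(\<exists>\<^sub>\<le>\<^sub>1w. valid_walk R' u v w \<or> valid_walk R' v u w) \<longleftrightarrow>
        (\<exists>\<^sub>\<le>\<^sub>1w. valid_walk R u v w \<or> valid_walk R v u w)" for u v
  proof
    assume *: "\<exists>\<^sub>\<le>\<^sub>1w. valid_walk R' u v w \<or> valid_walk R' v u w"
    show "\<exists>\<^sub>\<le>\<^sub>1w. valid_walk R u v w \<or> valid_walk R v u w"
    proof (rule Uniq_I)
      fix w w'
      assume w: "valid_walk R u v w \<or> valid_walk R v u w" "valid_walk R u v w' \<or> valid_walk R v u w'"
      then have "\<phi> w = \<phi> w'"
        using walk_bijection_image by (intro Uniq_D[OF *]) blast+
      then show "w = w'" using w walk_bijection_inj by blast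
    qed
  next
    assume *: "\<exists>\<^sub>\<le>\<^sub>1w. valid_walk R u v w \<or> valid_walk R v u w"
    show "\<exists>\<^sub>\<le>\<^sub>1w. valid_walk R' u v w \<or> valid_walk R' v u w"
    proof (rule Uniq_I)
      fix w w'
      assume "valid_walk R' u v w \<or> valid_walk R' v u w" "valid_walk R' u v w' \<or> valid_walk R' v u w'"
      then obtain t t' where "w = \<phi> t" "valid_walk R u v t \<or> valid_walk R v u t"
        "w' = \<phi> t'" "valid_walk R u v t' \<or> valid_walk R v u t'"
        using walk_bijection_image by blast
      then show "w = w'" using Uniq_D[OF *] by blast
    qed
  qed
  then show ?thesis unfolding unique_walks_def base by simp
qed

end

lemma walk_bijectionI:
  assumes "base R' = base R"
    and "\<And>u v w. valid_walk R u v w \<Longrightarrow> valid_walk R' u v (\<phi> w) \<and> \<psi> (\<phi> w) = w"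
    and "\<And>u v w. valid_walk R' u v w \<Longrightarrow> valid_walk R u v (\<psi> w) \<and> \<phi> (\<psi> w) = w"
    and "\<And>u v w. valid_walk R u v w \<Longrightarrow> walk_polarity R' (\<phi> w) = walk_polarity R w"
  shows "walk_bijection \<phi> R R'"
  unfolding walk_bijection_def
proof (intro conjI allI impI)
  fix u v
  show "bij_betw \<phi> {w. valid_walk R u v w} {w. valid_walk R' u v w}"
    by (rule bij_betwI[where g = \<psi>]) (use assms in auto)
qed (use assms in auto)

section \<open>Invariance under renaming\<close>

text \<open>Renaming every vertex of a walk by \<open>f\<close> is a bijection of walks, inverted by
  renaming back. A renamed auxiliary vertex is covered by the image of a walk through its
  preimage.\<close>

lemma aux_renaming_invariant:
  assumes "aux_renaming R R'"
  shows "realizes R' G p \<longleftrightarrow> realizes R G p" "strict_prn R \<Longrightarrow> strict_prn R'"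
proof -
  have prn: "prn R" "prn R'" and base: "base R' = base R"
    using assms by (simp_all add: aux_renaming_def)
  obtain f where bij: "bij_betw f (aux R) (aux R')" and fb: "\<forall>b \<in> base R. f b = b"
    and E: "edges R' = map_prod f f ` edges R"
    and pol': "\<forall>(u, v) \<in> edges R. v \<in> base R \<longrightarrow> pol R' (f u, f v) = pol R (u, v)"
    using assms unfolding aux_renaming_def by (elim conjE exE) (rule that)
  have pol: "pol R' (f u, f v) = pol R (u, v)" if "(u, v) \<in> edges R" "v \<in> base R" for u v
    using pol' that by blast
  have disj: "base R \<inter> aux R = {}" "base R \<inter> aux R' = {}"
    using prn base by (auto simp: prn_def)
  define g where "g = inv_into (base R \<union> aux R) f"
  have fA: "f a \<in> aux R'" if "a \<in> aux R" for a using bij that by (auto simp: bij_betw_def)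
  \<comment> \<open>\<open>f\<close> fixes the base and maps \<open>aux R\<close> into
    \<open>aux R'\<close>, which is disjoint from the base, so no collision occurs between the two
    kinds of vertices.\<close>
  have "inj_on f (base R \<union> aux R)"
  proof (rule inj_onI)
    fix a b
    assume "a \<in> base R \<union> aux R" "b \<in> base R \<union> aux R" "f a = f b"
    then show "a = b"
      using fb fA[of a] fA[of b] bij disj by (auto simp: bij_betw_def dest: inj_onD)
  qed
  then have gf: "g (f a) = a" if "a \<in> base R \<union> aux R" for a
    using that unfolding g_def by (rule inv_into_f_f)
  have gA: "g a \<in> aux R \<and> f (g a) = a" if "a \<in> aux R'" for a
  proof -
    have "a \<in> f ` aux R" using bij that by (simp add: bij_betw_def)
    then obtain c where "c \<in> aux R" "a = f c" by blast
    then show ?thesis using gf by simp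
  qed
  have gb: "g b = b" if "b \<in> base R" for b using gf[of b] fb that by simp
  have gE: "(g a, g b) \<in> edges R" if "(a, b) \<in> edges R'" for a b
    using that gf prn_edgeD[OF prn(1)] unfolding E by force
  have "walk_bijection (map f) R R'"
  proof (rule walk_bijectionI[where \<psi> = "map g", OF base])
    fix u v w
    assume w: "valid_walk R u v w"
    then obtain m where m: "w = u # m @ [v]" "set m \<subseteq> aux R" "u \<in> base R" "v \<in> base R" "edge_path R w"
      by (auto simp: valid_walk_iff)
    have "edge_path R' (map f w)"
      unfolding successively_map using m(5) by (rule successively_mono) (auto simp: E)
    moreover have "map f w = u # map f m @ [v]" "set (map f m) \<subseteq> aux R'"
      using m fb fA by auto
    moreover have "map g (map f w) = w"
      unfolding map_map using m gf by (auto intro!: map_idI)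
    ultimately show "valid_walk R' u v (map f w) \<and> map g (map f w) = w"
      using m(3,4) unfolding valid_walk_iff base by (intro conjI exI[of _ "map f m"])
    obtain l a where "w = l @ [a, v]" "(a, v) \<in> edges R"
      using valid_walk_last_edge[OF w] .
    then show "walk_polarity R' (map f w) = walk_polarity R w"
      using pol m(4) by (simp add: walk_polarity_append)
  next
    fix u v w
    assume w: "valid_walk R' u v w"
    then obtain m where m: "w = u # m @ [v]" "set m \<subseteq> aux R'" "u \<in> base R" "v \<in> base R" "edge_path R' w"
      unfolding valid_walk_iff base by blast
    have "successively (\<lambda>a b. (g a, g b) \<in> edges R) w"
      using m(5) by (rule successively_mono) (rule gE)
    then have "edge_path R (map g w)" by (simp only: successively_map)
    moreover have "map g w = u # map g m @ [v]" "set (map g m) \<subseteq> aux R"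
      using m(1-4) gb gA by auto
    moreover have "map f (map g w) = w"
      unfolding map_map
    proof (rule map_idI)
      fix a assume "a \<in> set w"
      then have "a \<in> base R \<or> a \<in> aux R'" using m(1-4) by auto
      then show "(f \<circ> g) a = a" using gA gb fb by auto
    qed
    ultimately show "valid_walk R u v (map g w) \<and> map f (map g w) = w"
      using m(3,4) unfolding valid_walk_iff by (intro conjI exI[of _ "map g m"])
  qed
  note \<phi> = this
  show "realizes R' G p \<longleftrightarrow> realizes R G p"
    by (rule walk_bijection_realizes[OF \<phi>])
  assume s: "strict_prn R"
  have "covered R'"
    unfolding covered_def
  proof
    fix a assume a: "a \<in> aux R'"
    then have "g a \<in> aux R" "f (g a) = a" using gA by auto
    moreover from this obtain u v w where "valid_walk R u v w" "g a \<in> set w"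
      using s unfolding strict_prn_iff covered_def by blast
    ultimately have "valid_walk R' u v (map f w)" "a \<in> set (map f w)"
      using walk_bijection_image[OF \<phi>] by force+
    then show "\<exists>u v w. valid_walk R' u v w \<and> a \<in> set w" by blast
  qed
  then show "strict_prn R'"
    using s prn walk_bijection_unique[OF \<phi>] by (simp add: strict_prn_iff)
qed

section \<open>Entering and leaving the auxiliary part\<close>

text \<open>This is the half of a valid walk that ends in \<open>a\<close>; \<open>exit\<close> is
  the half that starts there. The list \<open>[a]\<close> is allowed for a base vertex
  \<open>a\<close>, so both kinds of vertices can be treated alike.\<close>

definition entry :: "'v prn \<Rightarrow> 'v list \<Rightarrow> 'v \<Rightarrow> bool" where
  "entry R l a \<longleftrightarrow> l \<noteq> [] \<and> last l = a \<and> hd l \<in> base R \<and> set (tl l) \<subseteq> aux R \<and> edge_path R l"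

definition exit :: "'v prn \<Rightarrow> 'v list \<Rightarrow> 'v \<Rightarrow> bool" where
  "exit R l a \<longleftrightarrow> l \<noteq> [] \<and> hd l = a \<and> last l \<in> base R \<and> set (butlast l) \<subseteq> aux R \<and> edge_path R l"

text \<open>Cutting a valid walk at an auxiliary vertex on it yields both halves; a base vertex
  alone is already a half.\<close>

lemma covered_entry_exit:
  assumes "covered R" "base R \<inter> aux R = {}" "a \<in> base R \<union> aux R"
  shows "\<exists>l. entry R l a" "\<exists>l. exit R l a"
proof -
  have "(\<exists>l. entry R l a) \<and> (\<exists>l. exit R l a)"
  proof (cases "a \<in> base R")
    case True
    then have "entry R [a] a" "exit R [a] a" by (auto simp: entry_def exit_def)
    then show ?thesis by blast
  next
    case False
    then obtain u v w where "valid_walk R u v w" "a \<in> set w"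
      using assms by (auto simp: covered_def)
    then obtain m where m: "u \<in> base R" "v \<in> base R" "edge_path R (u # m @ [v])" "set m \<subseteq> aux R"
      "a \<in> set m"
      using False by (auto simp: valid_walk_iff)
    then obtain s t where st: "m = s @ a # t" by (auto simp: in_set_conv_decomp)
    have "edge_path R ((u # s @ [a]) @ t @ [v])" "edge_path R ((u # s) @ a # t @ [v])"
      using m(3) unfolding st by simp_all
    then have "edge_path R (u # s @ [a])" "edge_path R (a # t @ [v])"
      unfolding successively_append_iff by blast+
    then have "entry R (u # s @ [a]) a" "exit R (a # t @ [v]) a"
      using m st by (auto simp: entry_def exit_def butlast_append)
    then show ?thesis by blast
  qed
  then show "\<exists>l. entry R l a" "\<exists>l. exit R l a" by blast+
qed

text \<open>Two halves are glued along any auxiliary segment. Different choices of \<open>m\<close>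
  between the same \<open>l\<close> and \<open>k\<close> give different walks with common endpoints,
  which is how uniqueness is contradicted later.\<close>

lemma valid_walk_entry_exit:
  assumes l: "entry R l a" and k: "exit R k b"
    and m: "edge_path R (a # m @ [b])" "set m \<subseteq> aux R"
  shows "valid_walk R (hd l) (last k) (l @ m @ k)"
proof -
  have lk: "l = hd l # tl l" "k = butlast k @ [last k]"
    using l k by (auto simp: entry_def exit_def)
  \<comment> \<open>As \<open>k\<close> starts with \<open>b\<close>, the edge leaving
    \<open>a\<close> is the same whether \<open>k\<close> or \<open>[b]\<close> follows
    \<open>m\<close>, also when \<open>m\<close> is empty.\<close>
  have "hd (m @ k) = hd (m @ [b])" using k by (cases m) (auto simp: exit_def)
  then have "edge_path R (l @ m @ k)"
    using l k m unfolding entry_def exit_def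
    by (auto simp: successively_append_iff successively_Cons)
  moreover have "l @ m @ k = hd l # (tl l @ m @ butlast k) @ [last k]"
    using lk by (metis append.assoc append_Cons)
  moreover have "set (tl l @ m @ butlast k) \<subseteq> aux R"
    using l k m by (auto simp: entry_def exit_def)
  ultimately show ?thesis
    using l k unfolding valid_walk_iff entry_def exit_def by blast
qed

section \<open>Invariance under biclique reduction\<close>

text \<open>The vertex \<open>b\<close> stays in the recursive call because it ends one step and
  starts the next.\<close>

fun expand :: "'v set \<Rightarrow> 'v set \<Rightarrow> 'v \<Rightarrow> 'v list \<Rightarrow> 'v list" where
  "expand X Y z [] = []"
| "expand X Y z [a] = [a]"
| "expand X Y z (a # b # l) =
     (if a \<in> X \<and> b \<in> Y then a # z # expand X Y z (b # l) else a # expand X Y z (b # l))"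

section \<open>Effect of the insertion on the ends and members of a list\<close>

lemma hd_expand: "hd (expand X Y z (a # l)) = a" "expand X Y z (a # l) \<noteq> []"
  by (cases l; auto)+

lemma set_expand: "set w \<subseteq> set (expand X Y z w)" "set (expand X Y z w) \<subseteq> insert z (set w)"
  by (induction X Y z w rule: expand.induct) auto

lemma filter_expand: "z \<notin> set w \<Longrightarrow> filter (\<lambda>a. a \<noteq> z) (expand X Y z w) = w"
  by (induction X Y z w rule: expand.induct) auto

text \<open>The recursion runs from the front, but the polarity sits on the last edge; this exposes
  the effect at the far end.\<close>

lemma expand_append2:
  "expand X Y z (l @ [a, b]) = expand X Y z (l @ [a]) @ (if a \<in> X \<and> b \<in> Y then [z, b] else [b])"
proof (induction l)
  case (Cons c l)
  then show ?case by (cases l) auto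
qed simp

lemma last_expand: "\<exists>l'. expand X Y z (l @ [a]) = l' @ [a]"
  by (cases l rule: rev_cases) (auto simp: expand_append2)

lemma mem_expand:
  "\<lbrakk>a \<in> X; b \<in> Y\<rbrakk> \<Longrightarrow> z \<in> set (expand X Y z (l @ a # b # k))"
proof (induction l)
  case (Cons c l)
  then show ?case by (cases l) auto
qed simp

section \<open>The two networks of one biclique reduction\<close>

locale reduction =
  fixes R :: "'v prn" and X Y z
  assumes prn: "prn R" and biclique: "coherent_biclique R X Y" and fresh: "z \<notin> base R \<union> aux R"
begin

abbreviation "R' \<equiv> biclique_reduction R X Y z"

lemma prn': "prn R'"
  using reduces_prn prn biclique fresh unfolding reduces_def by blast

lemma base' [simp]: "base R' = base R" and aux' [simp]: "aux R' = insert z (aux R)"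
  by (simp_all add: biclique_reduction_def)

lemma XY: "X \<subseteq> base R \<union> aux R" "Y \<subseteq> base R \<union> aux R" "X \<noteq> {}" "Y \<noteq> {}"
  "a \<in> X \<Longrightarrow> b \<in> Y \<Longrightarrow> (a, b) \<in> edges R" "z \<notin> X" "z \<notin> Y"
  using biclique fresh by (auto simp: coherent_biclique_def)

lemma z_edge: "(z, a) \<notin> edges R" "(a, z) \<notin> edges R"
  using prn_edgeD[OF prn] fresh by blast+

lemma edges': "(a, b) \<in> edges R' \<longleftrightarrow>
    (a, b) \<in> edges R \<and> \<not> (a \<in> X \<and> b \<in> Y) \<or> a \<in> X \<and> b = z \<or> a = z \<and> b \<in> Y"
  by (auto simp: biclique_reduction_def)

lemma edge_path_expand: "edge_path R w \<Longrightarrow> edge_path R' (expand X Y z w)"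
proof (induction w rule: induct_list012)
  case (3 a b l)
  then have "edge_path R' (expand X Y z (b # l))" "(a, b) \<in> edges R" by simp_all
  then show ?case
    using hd_expand[of X Y z b l] by (auto simp: successively_Cons edges')
qed auto

text \<open>An inner \<open>z\<close> comes between some \<open>x \<in> X\<close> and
  \<open>y \<in> Y\<close>, so deleting it leaves an edge of \<open>R\<close>, and
  \<open>expand\<close> puts it back exactly there. The induction is on length because such a detour
  consumes two vertices at once.\<close>

lemma edge_path_filter:
  assumes "edge_path R' w" "w \<noteq> []" "hd w \<noteq> z" "last w \<noteq> z"
  shows "edge_path R (filter (\<lambda>a. a \<noteq> z) w) \<and> expand X Y z (filter (\<lambda>a. a \<noteq> z) w) = w"
  using assms
proof (induction w rule: length_induct)
  case (1 w)
  then obtain a l where w: "w = a # l" and a: "a \<noteq> z" by (cases w) auto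
  show ?case
  proof (cases l)
    case Nil
    then show ?thesis using w a by simp
  next
    case (Cons b k)
    show ?thesis
    proof (cases "b = z")
      case False
      then have "edge_path R (filter (\<lambda>a. a \<noteq> z) l) \<and> expand X Y z (filter (\<lambda>a. a \<noteq> z) l) = l"
        using "1.IH"[rule_format, of l] "1.prems" by (simp add: w Cons)
      \<comment> \<open>The edges of \<open>X \<times> Y\<close> are gone from \<open>R'\<close>, so
        \<open>expand\<close> inserts nothing at this step.\<close>
      moreover have "(a, b) \<in> edges R" "\<not> (a \<in> X \<and> b \<in> Y)"
        using "1.prems"(1) False a by (auto simp: w Cons edges')
      ultimately show ?thesis using False a by (auto simp: w Cons)
    next
      case True
      then obtain c k' where k: "k = c # k'" using "1.prems"(4) by (cases k) (auto simp: w Cons)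
      \<comment> \<open>All edges at \<open>z\<close> are new ones: they come from \<open>X\<close>
        or lead to \<open>Y\<close>.\<close>
      have ac: "a \<in> X" "c \<in> Y"
        using "1.prems"(1) True a z_edge XY(6,7) by (auto simp: w Cons k edges')
      then have cz: "c \<noteq> z" using XY by auto
      then have "edge_path R (filter (\<lambda>a. a \<noteq> z) k) \<and> expand X Y z (filter (\<lambda>a. a \<noteq> z) k) = k"
        using "1.IH"[rule_format, of k] "1.prems" by (simp add: w Cons k)
      then show ?thesis using True a ac cz XY(5) by (auto simp: w Cons k)
    qed
  qed
qed

text \<open>Deleting \<open>z\<close> inverts the expansion. If the last edge is replaced by a
  detour, coherence of the biclique keeps the polarity; otherwise the last edge is
  unchanged.\<close>

lemma walk_bijection_expand: "walk_bijection (expand X Y z) R R'"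
proof (rule walk_bijectionI[where \<psi> = "filter (\<lambda>a. a \<noteq> z)"])
  fix u v w
  assume w: "valid_walk R u v w"
  then obtain m where m: "w = u # m @ [v]" "set m \<subseteq> aux R" "u \<in> base R" "v \<in> base R" "edge_path R w"
    by (auto simp: valid_walk_iff)
  have zw: "z \<notin> set w" using m fresh by auto
  obtain k where k: "expand X Y z w = k @ [v]" using last_expand m(1) by (metis append_Cons)
  have "hd (expand X Y z w) = u" using m(1) hd_expand by metis
  \<comment> \<open>If \<open>k\<close> were empty, deleting \<open>z\<close> would leave at most
    one vertex, but \<open>w\<close> has at least two.\<close>
  moreover have "k \<noteq> []"
    using filter_expand[OF zw, of X Y] k m(1) by (auto split: if_splits)
  ultimately obtain m' where m': "expand X Y z w = u # m' @ [v]" using k by (cases k) auto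
  have "filter (\<lambda>a. a \<noteq> z) m' = m"
    using filter_expand[OF zw, of X Y] zw m(1) unfolding m' by (simp split: if_splits)
  then have "set m' \<subseteq> aux R'" using m(2) by auto
  then show "valid_walk R' u v (expand X Y z w) \<and> filter (\<lambda>a. a \<noteq> z) (expand X Y z w) = w"
    using m m' filter_expand[OF zw, of X Y] edge_path_expand[OF m(5)]
    unfolding valid_walk_iff by auto
  obtain l a where l: "w = l @ [a, v]" "(a, v) \<in> edges R"
    using valid_walk_last_edge[OF w] .
  have az: "a \<noteq> z" using l z_edge by auto
  show "walk_polarity R' (expand X Y z w) = walk_polarity R w"
  proof (cases "a \<in> X \<and> v \<in> Y")
    case True
    \<comment> \<open>The reduction copies the polarity from an arbitrarily chosen \<open>x\<close>;
      by coherence it agrees with that of \<open>a\<close>.\<close>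
    have "(SOME x. x \<in> X) \<in> X" using XY by (simp add: some_in_eq)
    then have "pol R (SOME x. x \<in> X, v) = pol R (a, v)"
      using True m(4) biclique unfolding coherent_biclique_def by blast
    then have "pol R' (z, v) = pol R (a, v)"
      using True m(4) by (simp add: biclique_reduction_def)
    then show ?thesis using True by (simp add: l expand_append2 walk_polarity_append)
  next
    case False
    moreover obtain l' where "expand X Y z (l @ [a]) = l' @ [a]" using last_expand by metis
    ultimately have "expand X Y z w = l' @ [a, v]" by (simp add: l expand_append2)
    moreover have "pol R' (a, v) = pol R (a, v)"
      using False az by (auto simp: biclique_reduction_def)
    ultimately show ?thesis by (simp add: l walk_polarity_append)
  qed
next
  fix u v w
  assume "valid_walk R' u v w"
  then obtain m where m: "w = u # m @ [v]" "set m \<subseteq> insert z (aux R)" "u \<in> base R" "v \<in> base R" "edge_path R' w"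
    by (auto simp: valid_walk_iff)
  have uv: "u \<noteq> z" "v \<noteq> z" using m fresh by auto
  then have "edge_path R (filter (\<lambda>a. a \<noteq> z) w) \<and> expand X Y z (filter (\<lambda>a. a \<noteq> z) w) = w"
    using m by (intro edge_path_filter) auto
  moreover have "filter (\<lambda>a. a \<noteq> z) w = u # filter (\<lambda>a. a \<noteq> z) m @ [v]"
    using uv m(1) by simp
  moreover have "set (filter (\<lambda>a. a \<noteq> z) m) \<subseteq> aux R" using m(2) by auto
  ultimately show "valid_walk R u v (filter (\<lambda>a. a \<noteq> z) w) \<and>
      expand X Y z (filter (\<lambda>a. a \<noteq> z) w) = w"
    using m unfolding valid_walk_iff by blast
qed simp

text \<open>Expansion loses no vertex and adds at most \<open>z\<close>. To cover \<open>z\<close>,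
  take an entry to some \<open>x \<in> X\<close>, the edge to some \<open>y \<in> Y\<close> and an
  exit from \<open>y\<close>; expanding this walk inserts \<open>z\<close> after
  \<open>x\<close>.\<close>

lemma covered_iff: "covered R' \<longleftrightarrow> covered R"
proof
  assume cov: "covered R'"
  show "covered R"
    unfolding covered_def
  proof
    fix a assume a: "a \<in> aux R"
    then obtain u v w where w: "valid_walk R u v w" "a \<in> set (expand X Y z w)"
      using cov walk_bijection_image[OF walk_bijection_expand] by (fastforce simp: covered_def)
    then have "a \<in> set w" using set_expand(2)[of X Y z w] a fresh by auto
    then show "\<exists>u v w. valid_walk R u v w \<and> a \<in> set w" using w by blast
  qed
next
  assume cov: "covered R"
  have expandI: "\<exists>u v w. valid_walk R' u v w \<and> a \<in> set w"
    if "valid_walk R u v w" "a \<in> set (expand X Y z w)" for u v w a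
    using that walk_bijection_image[OF walk_bijection_expand] by blast
  show "covered R'"
    unfolding covered_def
  proof
    fix a assume "a \<in> aux R'"
    then consider "a = z" | "a \<in> aux R" by auto
    then show "\<exists>u v w. valid_walk R' u v w \<and> a \<in> set w"
    proof cases
      case 1
      obtain x y where xy: "x \<in> X" "y \<in> Y" using XY by blast
      moreover have "base R \<inter> aux R = {}" using prn by (simp add: prn_def)
      ultimately obtain l k where lk: "entry R l x" "exit R k y"
        using XY covered_entry_exit[OF cov] by (meson subsetD)
      then have "valid_walk R (hd l) (last k) (l @ [] @ k)"
        by (rule valid_walk_entry_exit) (use xy XY in auto)
      moreover have "l = butlast l @ [x]" "k = y # tl k"
        using lk by (auto simp: entry_def exit_def)
      then have "l @ [] @ k = butlast l @ x # y # tl k"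
        by (metis append.assoc append_Cons append_Nil)
      ultimately show ?thesis
        using expandI mem_expand[OF xy] 1 by metis
    next
      case 2
      then obtain u v w where "valid_walk R u v w" "a \<in> set w"
        using cov unfolding covered_def by blast
      then show ?thesis
        using expandI set_expand(1) by (meson subsetD)
    qed
  qed
qed

lemma realizes_iff: "realizes R' G p \<longleftrightarrow> realizes R G p"
  by (rule walk_bijection_realizes[OF walk_bijection_expand])

lemma strict_iff: "strict_prn R' \<longleftrightarrow> strict_prn R"
  using prn prn' covered_iff walk_bijection_unique[OF walk_bijection_expand]
  by (simp add: strict_prn_iff)

end

section \<open>Undoing a biclique reduction\<close>

text \<open>Realization also speaks about \<open>u = v\<close>, so a loopless \<open>G\<close>
  excludes closed valid walks. Hence strictness, which concerns distinct endpoints, applies to every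
  pair joined by a walk.\<close>

lemma strict_realizing_acyclic:
  assumes "strict_prn R" "realizes R G p" "irrefl (parcs G)"
    and "valid_walk R u v w" "valid_walk R u v w'"
  shows "u \<noteq> v" "w = w'"
proof -
  have b: "u \<in> base R" "v \<in> base R" using assms(4) by (auto simp: valid_walk_iff)
  then show uv: "u \<noteq> v"
    using assms(2-4) unfolding realizes_def irrefl_def by metis
  show "w = w'"
    using assms(1,4,5) b uv unfolding strict_prn_def Uniq_def by blast
qed

text \<open>Reducing \<open>Q\<close> deletes all of \<open>X \<times> Y\<close>, so
  \<open>R\<close> is recovered only if it has no such edge itself; this and the disjointness of
  \<open>X\<close> and \<open>Y\<close> come from uniqueness of walks.\<close>

lemma strict_realizing_unreduce:
  assumes strict: "strict_prn R" and real: "realizes R G p" and irr: "irrefl (parcs G)"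
    and z: "z \<in> aux R"
  obtains Q X Y where "reduction Q X Y z" "R = biclique_reduction Q X Y z" "aux Q = aux R - {z}"
proof -
  define X where "X = {x. (x, z) \<in> edges R}"
  define Y where "Y = {y. (z, y) \<in> edges R}"
  \<comment> \<open>A shortcut \<open>(a, b)\<close> inherits the polarity of \<open>(z, b)\<close>,
    independent of \<open>a\<close>, which makes the biclique coherent. The value
    \<open>None\<close> at \<open>z\<close> keeps the domain exact.\<close>
  define Q where "Q = \<lparr>base = base R, aux = aux R - {z},
    edges = {(a, b) \<in> edges R. a \<noteq> z \<and> b \<noteq> z} \<union> X \<times> Y,
    pol = (\<lambda>(a, b). if (a, b) \<in> X \<times> Y then pol R (z, b) else if a = z then None else pol R (a, b))\<rparr>"
  have prn: "prn R" and cov: "covered R" using strict by (auto simp: strict_prn_iff)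
  have disj: "base R \<inter> aux R = {}" using prn by (simp add: prn_def)
  note wf = prn_edgeD[OF prn]
  note ee = covered_entry_exit[OF cov disj]
  have unique: "w = w'" if "valid_walk R u v w" "valid_walk R u v w'" for u v w w'
    using strict_realizing_acyclic[OF strict real irr that] by blast
  have zXY: "z \<notin> X" "z \<notin> Y" using wf(3) by (auto simp: X_def Y_def)
  have XV: "X \<subseteq> base R \<union> aux R" "Y \<subseteq> base R \<union> aux R" using wf(1,2) by (auto simp: X_def Y_def)
  \<comment> \<open>An entry to \<open>z\<close> starts in the base, so it has a vertex before
    \<open>z\<close>. The case of \<open>Y\<close> is the mirror image.\<close>
  have "X \<noteq> {}"
  proof -
    obtain l where l: "entry R l z" using ee z by blast
    then have *: "l = butlast l @ [z]" "butlast l \<noteq> []" using z disj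
      by (auto simp: entry_def) (metis append_Nil append_butlast_last_id disjoint_iff list.sel(1))
    then have "edge_path R (butlast l @ [z])" using l by (simp add: entry_def)
    then have "(last (butlast l), z) \<in> edges R"
      using *(2) by (simp add: successively_append_iff)
    then show ?thesis by (auto simp: X_def)
  qed
  moreover have "Y \<noteq> {}"
  proof -
    obtain l where l: "exit R l z" using ee z by blast
    then have *: "l = z # tl l" "tl l \<noteq> []" using z disj
      by (auto simp: exit_def) (metis disjoint_iff last_ConsL list.collapse)
    then have "edge_path R (z # tl l)" using l by (simp add: exit_def)
    then have "(z, hd (tl l)) \<in> edges R"
      using *(2) by (simp add: successively_Cons)
    then show ?thesis by (auto simp: Y_def)
  qed
  moreover have "X \<inter> Y = {}"
  proof (rule ccontr)
    assume "X \<inter> Y \<noteq> {}"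
    then obtain x where x: "(x, z) \<in> edges R" "(z, x) \<in> edges R" by (auto simp: X_def Y_def)
    show False
    proof (cases "x \<in> base R")
      case True
      \<comment> \<open>This walk is closed, which a loopless \<open>G\<close> excludes.\<close>
      then have "valid_walk R x x (x # [z] @ [x])"
        unfolding valid_walk_iff using x z by auto
      then show False using strict_realizing_acyclic(1)[OF strict real irr] by blast
    next
      case False
      then have xA: "x \<in> aux R" using wf x by blast
      \<comment> \<open>the cycle \<open>x \<rightarrow> z \<rightarrow> x\<close> can be run through once more, giving a second walk\<close>
      obtain l k where lk: "entry R l x" "exit R k z" using ee xA z by blast
      have "valid_walk R (hd l) (last k) (l @ [] @ k)"
        by (rule valid_walk_entry_exit[OF lk]) (use x in auto)
      moreover have "valid_walk R (hd l) (last k) (l @ [z, x] @ k)"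
        by (rule valid_walk_entry_exit[OF lk]) (use x xA z in auto)
      ultimately have "l @ [] @ k = l @ [z, x] @ k" by (rule unique)
      then have "length (l @ [] @ k) = length (l @ [z, x] @ k)" by (rule arg_cong)
      then show False by simp
    qed
  qed
  \<comment> \<open>The edge and the detour through \<open>z\<close> would extend to two walks of
    different length with the same endpoints.\<close>
  moreover have no_edge: "(x, y) \<notin> edges R" if "x \<in> X" "y \<in> Y" for x y
  proof
    assume e: "(x, y) \<in> edges R"
    have xy: "(x, z) \<in> edges R" "(z, y) \<in> edges R" using that by (auto simp: X_def Y_def)
    obtain l k where lk: "entry R l x" "exit R k y" using ee wf[OF e] by blast
    have "valid_walk R (hd l) (last k) (l @ [] @ k)"
      by (rule valid_walk_entry_exit[OF lk]) (use e in auto)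
    moreover have "valid_walk R (hd l) (last k) (l @ [z] @ k)"
      by (rule valid_walk_entry_exit[OF lk]) (use xy z in auto)
    ultimately have "l @ [] @ k = l @ [z] @ k" by (rule unique)
    then have "length (l @ [] @ k) = length (l @ [z] @ k)" by (rule arg_cong)
    then show False by simp
  qed
  moreover have dom: "(pol R (a, b) \<noteq> None) = ((a, b) \<in> edges R \<and> b \<in> base R)" for a b
    using prn unfolding prn_def by (auto simp: dom_def set_eq_iff)
  have zb: "z \<notin> base R" using z disj by blast
  have "prn Q"
  proof (rule prnI)
    show "base Q \<inter> aux Q = {}" using disj by (auto simp: Q_def)
    show "finite (base Q \<union> aux Q)" using prn_finite[OF prn] by (simp add: Q_def)
    show "u \<in> base Q \<union> aux Q \<and> v \<in> base Q \<union> aux Q \<and> u \<noteq> v" if "(u, v) \<in> edges Q" for u v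
      using that wf[of u v] XV zXY \<open>X \<inter> Y = {}\<close> by (auto simp: Q_def)
    have "(pol Q (a, b) \<noteq> None) = ((a, b) \<in> edges Q \<and> b \<in> base Q)" for a b
      using dom[of a b] dom[of z b] zb zXY by (auto simp: Q_def Y_def)
    then show "dom (pol Q) = {(u, v) \<in> edges Q. v \<in> base Q}" by (auto simp: dom_def)
  qed
  moreover have "coherent_biclique Q X Y"
    using calculation XV zXY by (auto simp: coherent_biclique_def Q_def)
  moreover have "z \<notin> base Q \<union> aux Q" using zb by (simp add: Q_def)
  ultimately have "reduction Q X Y z" by (simp add: reduction_def)
  moreover have "R = biclique_reduction Q X Y z"
  proof -
    \<comment> \<open>Any chosen \<open>x\<close> gives back the polarity of \<open>(z, b)\<close>,
      since \<open>Q\<close> stored that value on every \<open>(x, b)\<close> with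
      \<open>b \<in> Y\<close>.\<close>
    have x: "(SOME x. x \<in> X) \<in> X" using \<open>X \<noteq> {}\<close> by (simp add: some_in_eq)
    have "edges (biclique_reduction Q X Y z) = edges R"
      using no_edge by (auto simp: biclique_reduction_def Q_def X_def Y_def dest: wf(3))
    moreover have "pol (biclique_reduction Q X Y z) (a, b) = pol R (a, b)" for a b
      using x dom[of a b] no_edge[of a b] by (auto simp: biclique_reduction_def Q_def Y_def)
    ultimately show ?thesis
      using z by (intro prn.equality) (auto simp: biclique_reduction_def Q_def)
  qed
  moreover have "aux Q = aux R - {z}" by (simp add: Q_def)
  ultimately show thesis by (rule that)
qed

section \<open>Networks without auxiliary vertices\<close>

lemma polarized_diagram_props:
  assumes "polarized_diagram G p"
  shows "dom p = parcs G" "irrefl (parcs G)" "antisym (parcs G)"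
    "parcs G \<subseteq> pverts G \<times> pverts G"
proof -
  have prn: "prn (prn_of_diagram G p)" by (rule prn_of_diagram_prn[OF assms])
  show "irrefl (parcs G)"
    using prn_edgeD(3)[OF prn] by (auto simp: prn_of_diagram_def irrefl_def)
  show "parcs G \<subseteq> pverts G \<times> pverts G"
    using prn_edgeD(1,2)[OF prn] by (auto simp: prn_of_diagram_def)
  obtain D Or where D: "diagram D" "orientation_of (uedges D) Or"
    "G = \<lparr>pverts = dverts D, parcs = Or \<union> dedges D\<rparr>" "dom p = parcs G"
    using assms unfolding polarized_diagram_def polarized_diagram_of_def by blast
  show "dom p = parcs G" by (rule D(4))
  have Or: "{u, v} \<in> uedges D" "(v, u) \<notin> Or" if "(u, v) \<in> Or" for u v
    using D(2) that unfolding orientation_of_def by blast+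
  have dg: "\<not> ({u, v} \<in> uedges D \<and> (u, v) \<in> dedges D)" "\<not> ({u, v} \<in> uedges D \<and> (v, u) \<in> dedges D)"
    "\<not> ((u, v) \<in> dedges D \<and> (v, u) \<in> dedges D)" for u v
    using D(1) unfolding diagram_def by blast+
  show "antisym (parcs G)"
  proof (rule antisymI)
    fix u v
    assume "(u, v) \<in> parcs G" "(v, u) \<in> parcs G"
    then have "(u, v) \<in> Or \<or> (u, v) \<in> dedges D" "(v, u) \<in> Or \<or> (v, u) \<in> dedges D"
      by (auto simp: D(3))
    \<comment> \<open>An orientation never takes both directions, and the three kinds of edges of a
      diagram exclude each other on a pair; so each combination is contradictory.\<close>
    then show "u = v" using Or dg by blast
  qed
qed

lemma valid_walk_no_aux:
  assumes "aux R = {}"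
  shows "valid_walk R u v w \<longleftrightarrow> u \<in> base R \<and> v \<in> base R \<and> w = [u, v] \<and> (u, v) \<in> edges R"
  unfolding valid_walk_iff using assms by auto

lemma walk_polarity_edge: "walk_polarity R [u, v] = pol R (u, v)"
  using walk_polarity_append[of R "[]"] by simp

text \<open>Walks are single arcs here, so strictness amounts to antisymmetry of the arcs.\<close>

lemma prn_of_diagram_strict_realizes:
  assumes "polarized_diagram G p"
  shows "strict_prn (prn_of_diagram G p)" "realizes (prn_of_diagram G p) G p"
proof -
  have walk: "valid_walk (prn_of_diagram G p) u v w \<longleftrightarrow> w = [u, v] \<and> (u, v) \<in> parcs G" for u v w
    using polarized_diagram_props(4)[OF assms]
    by (subst valid_walk_no_aux) (auto simp: prn_of_diagram_def)
  show "strict_prn (prn_of_diagram G p)"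
    using prn_of_diagram_prn[OF assms] polarized_diagram_props(3)[OF assms]
    unfolding strict_prn_def walk
    by (auto simp: Uniq_def prn_of_diagram_def dest: antisymD)
  show "realizes (prn_of_diagram G p) G p"
    unfolding realizes_def walk by (auto simp: walk_polarity_edge prn_of_diagram_def)
qed

text \<open>Realization fixes edges and their polarities; off the arcs both polarity functions are
  undefined, so even the records agree.\<close>

lemma realizes_no_aux:
  assumes "polarized_diagram G p" "prn R" "realizes R G p" "aux R = {}"
  shows "R = prn_of_diagram G p"
proof -
  note G = polarized_diagram_props[OF assms(1)]
  have base: "base R = pverts G" using assms(3) by (simp add: realizes_def)
  have wf: "u \<in> pverts G" "v \<in> pverts G" if "(u, v) \<in> edges R" for u v
    using prn_edgeD[OF assms(2) that] assms(4) base by auto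
  have R: "(u, v) \<in> parcs G \<longleftrightarrow> (u, v) \<in> edges R \<and> pol R (u, v) = p (u, v)"
    "(u, v) \<notin> parcs G \<Longrightarrow> (u, v) \<notin> edges R"
    if "u \<in> pverts G" "v \<in> pverts G" for u v
    using assms(3) that walk_polarity_edge[of R u v]
    unfolding realizes_def valid_walk_no_aux[OF assms(4)] base by metis+
  have edges: "edges R = parcs G"
  proof (intro set_eqI)
    fix e
    show "e \<in> edges R \<longleftrightarrow> e \<in> parcs G"
    proof (cases e)
      case (Pair u v)
      then show ?thesis using R[of u v] wf[of u v] G(4) by blast
    qed
  qed
  have "pol R e = p e" for e
  proof (cases "e \<in> parcs G")
    case True
    then obtain u v where "e = (u, v)" "u \<in> pverts G" "v \<in> pverts G" using G(4) by blast
    then show ?thesis using R(1)[of u v] True by simp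
  next
    case False
    then have "e \<notin> dom (pol R)" "e \<notin> dom p"
      using assms(2) edges G(1) by (auto simp: prn_def)
    then show ?thesis by (simp add: domIff)
  qed
  then show ?thesis
    using base edges assms(4) by (intro prn.equality) (auto simp: prn_of_diagram_def)
qed

section \<open>Induction along the closure, and on the number of auxiliary vertices\<close>

theorem theorem36:
  fixes G :: "'v pair_pre_digraph" and p :: "'v \<times> 'v \<rightharpoonup> polarity" and R :: "'v prn"
  assumes "polarized_diagram G p" and "prn R"
  shows "prn_of_diagram G p \<hookrightarrow>\<^sup>* R \<longleftrightarrow> strict_prn R \<and> realizes R G p"
proof
  assume "prn_of_diagram G p \<hookrightarrow>\<^sup>* R"
  then show "strict_prn R \<and> realizes R G p"
    unfolding reduces_star_def
  proof (induction rule: rtranclp_induct)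
    case base
    then show ?case using prn_of_diagram_strict_realizes[OF assms(1)] by blast
  next
    case (step S S')
    from step.hyps(2) show ?case
    proof
      assume "S \<hookrightarrow> S'"
      then obtain X Y z where "reduction S X Y z" "S' = biclique_reduction S X Y z"
        unfolding reduces_def reduction_def by blast
      then show ?case
        using step.IH reduction.strict_iff reduction.realizes_iff by metis
    next
      assume "aux_renaming S S'"
      then show ?case using step.IH aux_renaming_invariant by metis
    qed
  qed
next
  assume "strict_prn R \<and> realizes R G p"
  moreover have "finite (aux R)" using prn_finite[OF assms(2)] by simp
  ultimately show "prn_of_diagram G p \<hookrightarrow>\<^sup>* R"
  proof (induction "card (aux R)" arbitrary: R)
    case 0
    then have "R = prn_of_diagram G p"
      using realizes_no_aux[OF assms(1)] by (simp add: strict_prn_def)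
    then show ?case by (simp add: reduces_star_def)
  next
    case (Suc n)
    then obtain z where z: "z \<in> aux R" by fastforce
    obtain Q X Y where Q: "reduction Q X Y z" "R = biclique_reduction Q X Y z"
      "aux Q = aux R - {z}"
      using strict_realizing_unreduce[of R G p z] Suc.prems z polarized_diagram_props(2)[OF assms(1)]
      by blast
    \<comment> \<open>Invariance is an equivalence, so it passes from the reduction \<open>R\<close>
      back to \<open>Q\<close>.\<close>
    have "strict_prn Q \<and> realizes Q G p"
      using Suc.prems Q reduction.strict_iff reduction.realizes_iff by metis
    moreover have "n = card (aux Q)" "finite (aux Q)"
      using Q(3) Suc z by (auto simp: card_Diff_singleton_if)
    ultimately have "prn_of_diagram G p \<hookrightarrow>\<^sup>* Q" using Suc.hyps(1) by blast
    moreover have "Q \<hookrightarrow> R" using Q unfolding reduces_def reduction_def by blast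
    ultimately show ?case unfolding reduces_star_def by (auto intro: rtranclp.rtrancl_into_rtrancl)
  qed
qed

end
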